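(* Let $K$ be a field, $P=\{p_1,\dots,p_n\}$ a finite poset, and $r$ a positive integer. Let $T$ be the polynomial ring over $K$ in the variables $y_{\mathcal{I}}$, $\mathcal{I}\in\mathcal{I}_r(P)$, and let $\varphi:T\to R_r(P)$ be the $K$-algebra homomorphism with $\varphi(y_{\mathcal{I}})=u_{\mathcal{I}}$. Then the presentation ideal $\operatorname{Ker}\varphi$ of $R_r(P)$ is generated by the binomials $y_{\mathcal{I}}y_{\mathcal{J}}-y_{\mathcal{I}\cap\mathcal{J}}y_{\mathcal{I}\cup\mathcal{J}}$, where $\mathcal{I},\mathcal{J}\in\mathcal{I}_r(P)$ are incomparable $r$-multichains.
   Context: An order ideal of $P$ is a subset $I$ with $y\leq x\in I\Rightarrow y\in I$. An $r$-multichain in $P$ is a chain of order ideals $\mathcal{I}: I_1\subseteq I_2\subseteq\cdots\subseteq I_{r-1}\subseteq I_r=P$. The set $\mathcal{I}_r(P)$ of all $r$-multichains is partially ordered by componentwise inclusion, and is a distributive lattice under componentwise union $\mathcal{I}\cup\mathcal{J}$ and componentwise intersection $\mathcal{I}\cap\mathcal{J}$. To $\mathcal{I}\in\mathcal{I}_r(P)$ one associates the monomial $u_{\mathcal{I}}=\prod_{k=1}^r\prod_{p_\ell\in I_k\setminus I_{k-1}}x_{k\ell}$ (with $I_0=\emptyset$) in $S=K[x_{ij}:1\leq i\leq r,1\leq j\leq n]$. The generalized Hibi ring $R_r(P)$ is the $K$-subalgebra of $S$ generated by all $u_{\mathcal{I}}$, $\mathcal{I}\in\mathcal{I}_r(P)$.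 *)

theory Defs
  imports
    "HOL-Library.Poly_Mapping"
    "HOL-Algebra.Ideal"
    "HOL-Algebra.Subrings"
begin

section \<open>Multivariate polynomials\<close>

text \<open>
  Polynomials with variables in \<^typ>\<open>'v\<close> are finitely supported maps from monomials (finitely
  supported exponent vectors) to coefficients; \<^theory>\<open>HOL-Library.Poly_Mapping\<close> supplies the
  convolution product.
\<close>

type_synonym ('v, 'k) mpoly = "('v \<Rightarrow>\<^sub>0 nat) \<Rightarrow>\<^sub>0 'k"

definition pconst :: "'k::zero \<Rightarrow> ('v, 'k) mpoly" where
  "pconst c = Poly_Mapping.single 0 c"

definition pvar :: "'v \<Rightarrow> ('v, 'k::zero_neq_one) mpoly" where
  "pvar v = Poly_Mapping.single (Poly_Mapping.single v 1) 1"

definition pvars :: "('v, 'k::zero) mpoly \<Rightarrow> 'v set" where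
  "pvars f = (\<Union>m\<in>Poly_Mapping.keys f. Poly_Mapping.keys m)"

definition mpoly_ring :: "'v set \<Rightarrow> ('v, 'k::comm_ring_1) mpoly ring" where
  "mpoly_ring V = \<lparr>carrier = {f. pvars f \<subseteq> V}, mult = (*), one = 1, zero = 0, add = (+)\<rparr>"

text \<open>
  A (unital) \<open>K\<close>-subalgebra of a polynomial ring over \<open>K\<close> is a subring containing the constants.
  Note that the locale \<open>subalgebra\<close> of \<open>HOL-Algebra\<close> only describes linear subspaces.
\<close>

definition subalgebra_generated :: "'v set \<Rightarrow> ('v, 'k::comm_ring_1) mpoly set \<Rightarrow> ('v, 'k) mpoly set"
  where "subalgebra_generated V X =
    \<Inter>{A. subring A (mpoly_ring V) \<and> range pconst \<subseteq> A \<and> X \<subseteq> A}"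

definition algebra_hom ::
  "('v, 'k::comm_ring_1) mpoly ring \<Rightarrow> ('w, 'k) mpoly ring \<Rightarrow> (('v, 'k) mpoly \<Rightarrow> ('w, 'k) mpoly) set"
  where "algebra_hom A B = {\<phi> \<in> ring_hom A B. \<forall>c. \<phi> (pconst c) = pconst c}"


section \<open>Multichains of order ideals and generalized Hibi rings\<close>

text \<open>The finite poset is a carrier \<open>P\<close> with order relation \<open>leq\<close>; \<open>(x, y) \<in> leq\<close> means \<open>x \<le> y\<close>.\<close>

definition order_ideal :: "'p set \<Rightarrow> 'p rel \<Rightarrow> 'p set \<Rightarrow> bool" where
  "order_ideal P leq I \<longleftrightarrow> I \<subseteq> P \<and> (\<forall>x\<in>I. \<forall>y\<in>P. (y, x) \<in> leq \<longrightarrow> y \<in> I)"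

text \<open>
  An \<open>r\<close>-multichain \<open>I\<^sub>1 \<subseteq> \<dots> \<subseteq> I\<^sub>r = P\<close> is encoded as a function on all of \<^typ>\<open>nat\<close>, using the
  convention \<open>I\<^sub>0 = \<emptyset>\<close> and continuing constantly with \<open>P\<close> beyond \<open>r\<close>. Thus (for \<open>r \<ge> 1\<close>) every
  multichain is represented by exactly one function, the order on functions is componentwise
  inclusion, and pointwise unions and intersections are again of this form.
\<close>

definition multichains :: "nat \<Rightarrow> 'p set \<Rightarrow> 'p rel \<Rightarrow> (nat \<Rightarrow> 'p set) set" where
  "multichains r P leq = {I. I 0 = {} \<and>
     (\<forall>k\<in>{1..r}. order_ideal P leq (I k)) \<and>
     (\<forall>k\<in>{1..<r}. I k \<subseteq> I (Suc k)) \<and>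
     (\<forall>k\<ge>r. I k = P)}"

text \<open>The variable \<open>x\<^bsub>k\<ell>\<^esub>\<close> attached to \<open>p\<^sub>\<ell> \<in> P\<close> is indexed by the pair \<open>(k, p\<^sub>\<ell>)\<close>.\<close>

definition multichain_monomial ::
  "nat \<Rightarrow> (nat \<Rightarrow> 'p set) \<Rightarrow> (nat \<times> 'p, 'k::comm_ring_1) mpoly" where
  "multichain_monomial r I = (\<Prod>k=1..r. \<Prod>p\<in>I k - I (k - 1). pvar (k, p))"

definition hibi_ring :: "nat \<Rightarrow> 'p set \<Rightarrow> 'p rel \<Rightarrow> (nat \<times> 'p, 'k::comm_ring_1) mpoly ring" where
  "hibi_ring r P leq =
    (mpoly_ring ({1..r} \<times> P))
      \<lparr>carrier := subalgebra_generated ({1..r} \<times> P) (multichain_monomial r ` multichains r P leq)\<rparr>"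


section \<open>The presentation map exists\<close>

lemma pvars_add: "pvars (f + g) \<subseteq> pvars f \<union> pvars g"
  using Poly_Mapping.keys_add[of f g] unfolding pvars_def by blast

lemma pvars_mult: "pvars (f * g) \<subseteq> pvars f \<union> pvars (g :: ('v, 'k::comm_ring_1) mpoly)"
proof
  fix v assume "v \<in> pvars (f * g)"
  then obtain m where m: "m \<in> Poly_Mapping.keys (f * g)" "v \<in> Poly_Mapping.keys m"
    unfolding pvars_def by blast
  then obtain a b where ab: "a \<in> Poly_Mapping.keys f" "b \<in> Poly_Mapping.keys g" "m = a + b"
    using Poly_Mapping.keys_mult[of f g] by blast
  then show "v \<in> pvars f \<union> pvars g"
    using m Poly_Mapping.keys_add[of a b] unfolding pvars_def by blast
qed

lemma pvars_uminus: "pvars (- f) = pvars (f :: ('v, 'k::comm_ring_1) mpoly)"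
  by (auto simp: pvars_def in_keys_iff)

lemma pvars_0 [simp]: "pvars 0 = {}"
  by (simp add: pvars_def)

lemma pvars_pconst [simp]: "pvars (pconst c) = {}"
  by (simp add: pvars_def pconst_def)

lemma pvars_1 [simp]: "pvars (1 :: ('v, 'k::comm_ring_1) mpoly) = {}"
  by (simp add: pvars_def)

lemma pvars_pvar [simp]: "pvars (pvar v :: ('v, 'k::comm_ring_1) mpoly) = {v}"
  by (simp add: pvars_def pvar_def)

lemma mpoly_ring_sel [simp]:
  "carrier (mpoly_ring V) = {f. pvars f \<subseteq> V}"
  "mult (mpoly_ring V) = (*)" "one (mpoly_ring V) = 1"
  "zero (mpoly_ring V) = 0" "add (mpoly_ring V) = (+)"
  by (simp_all add: mpoly_ring_def)

lemma mpoly_ring_cring: "cring (mpoly_ring V :: ('v, 'k::comm_ring_1) mpoly ring)"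
proof (rule cringI)
  show "abelian_group (mpoly_ring V :: ('v, 'k) mpoly ring)"
  proof (rule abelian_groupI)
    fix x :: "('v, 'k) mpoly"
    assume "x \<in> carrier (mpoly_ring V)"
    then show "\<exists>y\<in>carrier (mpoly_ring V). y \<oplus>\<^bsub>mpoly_ring V\<^esub> x = \<zero>\<^bsub>mpoly_ring V\<^esub>"
      by (intro bexI[of _ "- x"]) (auto simp: pvars_uminus)
  qed (auto simp: algebra_simps dest: subsetD[OF pvars_add])
  show "Group.comm_monoid (mpoly_ring V :: ('v, 'k) mpoly ring)"
    by (rule comm_monoidI) (auto simp: algebra_simps dest: subsetD[OF pvars_mult])
qed (auto simp: algebra_simps)

lemma subalgebra_generated_subring:
  assumes "X \<subseteq> carrier (mpoly_ring V)"
  shows "subring (subalgebra_generated V X) (mpoly_ring V)"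
proof -
  interpret cring "mpoly_ring V :: ('a, 'b) mpoly ring" by (rule mpoly_ring_cring)
  have "carrier (mpoly_ring V) \<in> {A. subring A (mpoly_ring V) \<and> range pconst \<subseteq> A \<and> X \<subseteq> A}"
    using carrier_is_subring assms by auto
  then show ?thesis
    unfolding subalgebra_generated_def by (intro subring_Inter) blast+
qed

lemma subalgebra_generated_const: "pconst c \<in> subalgebra_generated V X"
  by (auto simp: subalgebra_generated_def)

lemma subalgebra_generated_incl: "X \<subseteq> subalgebra_generated V X"
  by (auto simp: subalgebra_generated_def)

lemma pvars_prod:
  "pvars (\<Prod>i\<in>A. f i :: ('v, 'k::comm_ring_1) mpoly) \<subseteq> (\<Union>i\<in>A. pvars (f i))"
  by (induction A rule: infinite_finite_induct) (use pvars_mult in fastforce)+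

lemma multichain_monomial_carrier:
  assumes "I \<in> multichains r P leq"
  shows "multichain_monomial r I \<in> carrier (mpoly_ring ({1..r} \<times> P))"
proof -
  have "pvars (multichain_monomial r I :: (nat \<times> 'a, 'b) mpoly) \<subseteq>
      (\<Union>k\<in>{1..r}. \<Union>p\<in>I k - I (k - 1). {(k, p)})"
    unfolding multichain_monomial_def
    by (intro order_trans[OF pvars_prod] UN_mono subset_refl order_trans[OF pvars_prod]) auto
  also have "\<dots> \<subseteq> {1..r} \<times> P"
  proof (intro UN_least)
    fix k p assume k: "k \<in> {1..r}" and p: "p \<in> I k - I (k - 1)"
    have "I k \<subseteq> P"
      using assms k unfolding multichains_def order_ideal_def by simp
    then show "{(k, p)} \<subseteq> {1..r} \<times> P"
      using k p by auto
  qed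
  finally show ?thesis
    by simp
qed

definition psubst :: "('v \<Rightarrow> ('w, 'k::comm_ring_1) mpoly) \<Rightarrow> ('v, 'k) mpoly \<Rightarrow> ('w, 'k) mpoly"
  where "psubst u f = (\<Sum>m\<in>Poly_Mapping.keys f.
    pconst (Poly_Mapping.lookup f m) *
      (\<Prod>v\<in>Poly_Mapping.keys m. u v ^ Poly_Mapping.lookup m v))"

lemma pconst_0 [simp]: "pconst 0 = 0" by (simp add: pconst_def)
lemma pconst_1 [simp]: "pconst 1 = 1" by (simp add: pconst_def)
lemma pconst_add: "pconst (a + b) = pconst a + pconst b" by (simp add: pconst_def single_add)
lemma pconst_mult: "pconst (a * b) = pconst a * pconst (b :: 'k::comm_ring_1)"
  by (simp add: pconst_def mult_single)

lemma psubst_superset: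
  assumes "finite A" "Poly_Mapping.keys f \<subseteq> A"
  shows "psubst u f = (\<Sum>m\<in>A. pconst (Poly_Mapping.lookup f m) *
    (\<Prod>v\<in>Poly_Mapping.keys m. u v ^ Poly_Mapping.lookup m v))"
  unfolding psubst_def
  by (rule sum.mono_neutral_left) (use assms in \<open>auto simp: in_keys_iff\<close>)

lemma psubst_add: "psubst u (f + g) = psubst u f + psubst u g"
proof -
  let ?A = "Poly_Mapping.keys f \<union> Poly_Mapping.keys g"
  have "Poly_Mapping.keys (f + g) \<subseteq> ?A" by (rule Poly_Mapping.keys_add)
  then show ?thesis
    by (simp add: psubst_superset[of ?A] lookup_add pconst_add algebra_simps sum.distrib)
qed

lemma psubst_0: "psubst u 0 = 0" by (simp add: psubst_def)

lemma psubst_sum: "psubst u (\<Sum>i\<in>A. f i) = (\<Sum>i\<in>A. psubst u (f i))"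
  by (induction A rule: infinite_finite_induct) (auto simp: psubst_add psubst_0)

lemma psubst_single:
  "psubst u (Poly_Mapping.single m c) =
    pconst c * (\<Prod>v\<in>Poly_Mapping.keys m. u v ^ Poly_Mapping.lookup m v)"
  by (subst psubst_superset[of "{m}"]) auto

lemma monomial_subst_add:
  "(\<Prod>v\<in>Poly_Mapping.keys (m + n). (u v :: 'a::comm_ring_1) ^ Poly_Mapping.lookup (m + n) v) =
   (\<Prod>v\<in>Poly_Mapping.keys m. u v ^ Poly_Mapping.lookup m v) *
   (\<Prod>v\<in>Poly_Mapping.keys n. u v ^ Poly_Mapping.lookup n v)"
proof -
  let ?A = "Poly_Mapping.keys m \<union> Poly_Mapping.keys n"
  have *: "(\<Prod>v\<in>Poly_Mapping.keys l. u v ^ Poly_Mapping.lookup l v) =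
      (\<Prod>v\<in>?A. u v ^ Poly_Mapping.lookup l v)" if "Poly_Mapping.keys l \<subseteq> ?A" for l
    by (rule prod.mono_neutral_left) (use that in \<open>auto simp: in_keys_iff\<close>)
  show ?thesis
    unfolding *[OF Poly_Mapping.keys_add] *[OF Un_upper1] *[OF Un_upper2]
    by (simp add: lookup_add power_add prod.distrib)
qed

lemma mpoly_eq_sum_single:
  "f = (\<Sum>m\<in>Poly_Mapping.keys f. Poly_Mapping.single m (Poly_Mapping.lookup f m))"
  by (rule poly_mapping_eqI)
    (auto simp: lookup_sum lookup_single when_def in_keys_iff sum.delta')

lemma psubst_mult: "psubst u (f * g) = psubst u f * psubst u g"
proof -
  have "f * g = (\<Sum>m\<in>Poly_Mapping.keys f. \<Sum>n\<in>Poly_Mapping.keys g.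
      Poly_Mapping.single (m + n) (Poly_Mapping.lookup f m * Poly_Mapping.lookup g n))"
    by (subst (1) mpoly_eq_sum_single[of f], subst (1) mpoly_eq_sum_single[of g])
      (simp add: sum_product mult_single)
  then show ?thesis
    by (simp add: psubst_sum psubst_single monomial_subst_add pconst_mult)
      (simp add: psubst_def sum_product algebra_simps)
qed

lemma psubst_pconst: "psubst u (pconst c) = pconst c"
  using psubst_single[of u 0 c] by (simp add: pconst_def)

lemma psubst_pvar: "psubst u (pvar v) = u v"
  by (simp add: pvar_def psubst_single)

lemma psubst_in_subring:
  assumes A: "subring A (mpoly_ring V)" "range pconst \<subseteq> A"
    and u: "\<And>v. v \<in> pvars f \<Longrightarrow> u v \<in> A"
  shows "psubst u f \<in> A"
proof -
  interpret cring "mpoly_ring V :: ('a, 'b) mpoly ring" by (rule mpoly_ring_cring)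
  have add: "x + y \<in> A" and mult: "x * y \<in> A" if "x \<in> A" "y \<in> A" for x y
    using subringE(6,7)[OF A(1)] that by auto
  have zero: "0 \<in> A" and one: "1 \<in> A"
    using subringE(2,3)[OF A(1)] by auto
  have pow: "x ^ n \<in> A" if "x \<in> A" for x n
    by (induction n) (auto simp: one mult that)
  have prod: "(\<Prod>i\<in>B. h i) \<in> A" if "\<And>i. i \<in> B \<Longrightarrow> h i \<in> A" for B and h :: "'c \<Rightarrow> _"
    using that by (induction B rule: infinite_finite_induct) (auto simp: one mult)
  have sum: "(\<Sum>i\<in>B. h i) \<in> A" if "\<And>i. i \<in> B \<Longrightarrow> h i \<in> A"
    for B and h :: "('c \<Rightarrow>\<^sub>0 nat) \<Rightarrow> _"
    using that by (induction B rule: infinite_finite_induct) (auto simp: zero add)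
  show ?thesis
    unfolding psubst_def
  proof (rule sum, rule mult)
    fix m assume "m \<in> Poly_Mapping.keys f"
    then show "(\<Prod>v\<in>Poly_Mapping.keys m. u v ^ Poly_Mapping.lookup m v) \<in> A"
      by (intro prod pow u) (auto simp: pvars_def)
  qed (use A in auto)
qed

lemma presentation_map_exists:
  fixes P :: "'p set" and leq :: "'p rel"
  shows "\<exists>\<phi> :: (nat \<Rightarrow> 'p set, 'k::field) mpoly \<Rightarrow> (nat \<times> 'p, 'k) mpoly.
    \<phi> \<in> algebra_hom (mpoly_ring (multichains r P leq)) (hibi_ring r P leq) \<and>
    (\<forall>I\<in>multichains r P leq. \<phi> (pvar I) = multichain_monomial r I)"
proof (intro exI conjI ballI)
  let ?u = "multichain_monomial r :: (nat \<Rightarrow> 'p set) \<Rightarrow> (nat \<times> 'p, 'k) mpoly"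
  let ?G = "?u ` multichains r P leq"
  have sub: "subring (subalgebra_generated ({1..r} \<times> P) ?G) (mpoly_ring ({1..r} \<times> P))"
    by (rule subalgebra_generated_subring) (use multichain_monomial_carrier in blast)
  have "psubst ?u f \<in> subalgebra_generated ({1..r} \<times> P) ?G"
    if "pvars f \<subseteq> multichains r P leq" for f
    by (rule psubst_in_subring[OF sub])
      (use that subalgebra_generated_const subalgebra_generated_incl in blast)+
  moreover have "psubst ?u 1 = 1"
    using psubst_pconst[of ?u 1] by simp
  ultimately show "psubst ?u \<in> algebra_hom (mpoly_ring (multichains r P leq)) (hibi_ring r P leq)"
    by (auto simp: algebra_hom_def hibi_ring_def ring_hom_def psubst_add psubst_mult psubst_pconst)
  show "psubst ?u (pvar I) = ?u I" for I
    by (rule psubst_pvar)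
qed

end

theory Submission
  imports Defs
begin

text \<open>
  Given multichains \<open>I\<^sub>1, \<dots>, I\<^sub>d\<close>, let \<open>L\<^sub>j\<close> consist at each place \<open>k\<close> of those \<open>p\<close> that lie in at least
  \<open>j\<close> of the sets \<open>I\<^sub>i k\<close>. Then \<open>L\<^sub>1 \<supseteq> \<dots> \<supseteq> L\<^sub>d\<close> are multichains, and inserting the \<open>I\<^sub>i\<close> one after
  another into such a chain by the exchange \<open>I, J \<mapsto> I \<inter> J, I \<union> J\<close> shows that the product of the
  variables of the \<open>I\<^sub>i\<close> is congruent, modulo the binomials, to the product of the variables of the
  \<open>L\<^sub>j\<close>. The numbers of occurrences of \<open>p\<close> at place \<open>k\<close> can be read off the image monomial, and \<open>d\<close> is
  such a number as \<open>P\<close> is nonempty. Hence monomials with equal image are congruent. A polynomial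
  in the kernel has coefficient sum \<open>0\<close> on each fibre of the monomial map, so it is a combination of
  differences of such monomials.
\<close>

section \<open>Ideals of polynomial rings\<close>

lemma mpoly_ideal_closed:
  assumes "ideal A (mpoly_ring V :: ('v, 'k::comm_ring_1) mpoly ring)"
  shows "0 \<in> A"
    and "f \<in> A \<Longrightarrow> g \<in> A \<Longrightarrow> f + g \<in> A"
    and "f \<in> A \<Longrightarrow> pvars h \<subseteq> V \<Longrightarrow> h * f \<in> A"
proof -
  interpret ideal A "mpoly_ring V" by (rule assms)
  show "0 \<in> A" using additive_subgroup.zero_closed[OF is_additive_subgroup] by simp
  show "f + g \<in> A" if "f \<in> A" "g \<in> A" using additive_subgroup.a_closed[OF is_additive_subgroup that] by simp
  show "h * f \<in> A" if "f \<in> A" "pvars h \<subseteq> V" using I_l_closed[OF that(1), of h] that(2) by simp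
qed

lemma mpoly_ideal_uminus:
  assumes A: "ideal A (mpoly_ring V :: ('v, 'k::comm_ring_1) mpoly ring)" and "f \<in> A"
  shows "- f \<in> A"
  using mpoly_ideal_closed(3)[OF A \<open>f \<in> A\<close>, of "- 1"] by (simp add: pvars_uminus)

lemma mpoly_ideal_trans:
  assumes "ideal A (mpoly_ring V :: ('v, 'k::comm_ring_1) mpoly ring)"
    and "f - g \<in> A" "g - h \<in> A"
  shows "f - h \<in> A"
  using mpoly_ideal_closed(2)[OF assms] by simp

lemma mpoly_ideal_mult_cong:
  assumes "ideal A (mpoly_ring V :: ('v, 'k::comm_ring_1) mpoly ring)"
    and "f - g \<in> A" "pvars h \<subseteq> V"
  shows "h * f - h * g \<in> A"
  using mpoly_ideal_closed(3)[OF assms] by (simp add: algebra_simps)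

lemma mpoly_ideal_sum:
  assumes A: "ideal A (mpoly_ring V :: ('v, 'k::comm_ring_1) mpoly ring)"
    and "\<And>i. i \<in> B \<Longrightarrow> f i \<in> A"
  shows "(\<Sum>i\<in>B. f i) \<in> A"
  using assms(2)
  by (induction B rule: infinite_finite_induct) (auto intro: mpoly_ideal_closed[OF A])

lemma single_eq_pconst_mult:
  "Poly_Mapping.single m c = pconst c * Poly_Mapping.single m (1 :: 'k::comm_ring_1)"
  by (simp add: pconst_def mult_single)

text \<open>In each fibre of \<open>e\<close> a representative is fixed. Replacing every monomial of
  \<open>f\<close> by its representative gives 0, as the coefficients on a fibre sum to 0.
  Subtracting this 0 writes \<open>f\<close> as a combination of the differences
  \<open>?y m - ?y (s (e m))\<close>, which lie in \<open>A\<close>.\<close>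

lemma fibrewise_zero_in_ideal:
  fixes f :: "('v, 'k::comm_ring_1) mpoly"
  assumes A: "ideal A (mpoly_ring V)"
    and cong: "\<And>m n. m \<in> Poly_Mapping.keys f \<Longrightarrow> n \<in> Poly_Mapping.keys f \<Longrightarrow> e m = e n \<Longrightarrow>
      Poly_Mapping.single m 1 - Poly_Mapping.single n 1 \<in> A"
    and zero: "\<And>E. (\<Sum>m | m \<in> Poly_Mapping.keys f \<and> e m = E. Poly_Mapping.lookup f m) = 0"
  shows "f \<in> A"
proof -
  let ?K = "Poly_Mapping.keys f" and ?c = "Poly_Mapping.lookup f"
  let ?y = "\<lambda>m. Poly_Mapping.single m 1 :: ('v, 'k) mpoly"
  define s where "s E = (SOME m. m \<in> ?K \<and> e m = E)" for E
  have s: "s (e m) \<in> ?K" "e (s (e m)) = e m" if "m \<in> ?K" for m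
    using someI[of "\<lambda>n. n \<in> ?K \<and> e n = e m" m] that unfolding s_def by auto
  have fib: "(\<Sum>m\<in>{m\<in>?K. e m = E}. pconst (?c m) * ?y (s (e m))) = 0" for E
  proof -
    have "(\<Sum>m\<in>{m\<in>?K. e m = E}. pconst (?c m) * ?y (s (e m))) =
        (\<Sum>m\<in>{m\<in>?K. e m = E}. pconst (?c m)) * ?y (s E)"
      by (simp add: sum_distrib_right)
    also have "(\<Sum>m\<in>{m\<in>?K. e m = E}. pconst (?c m)) =
        (pconst (\<Sum>m\<in>{m\<in>?K. e m = E}. ?c m) :: ('v, 'k) mpoly)"
      by (induction rule: infinite_finite_induct) (auto simp: pconst_add)
    finally show ?thesis by (simp add: zero)
  qed
  have "(\<Sum>m\<in>?K. pconst (?c m) * ?y (s (e m))) =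
      (\<Sum>E\<in>e ` ?K. \<Sum>m\<in>{m\<in>?K. e m = E}. pconst (?c m) * ?y (s (e m)))"
    by (rule sum.image_gen) simp
  also have "\<dots> = 0" by (simp only: fib sum.neutral_const)
  finally have "(\<Sum>m\<in>?K. pconst (?c m) * ?y (s (e m))) = 0" .
  moreover have "f = (\<Sum>m\<in>?K. pconst (?c m) * ?y m)"
    unfolding single_eq_pconst_mult[symmetric] by (rule mpoly_eq_sum_single)
  ultimately have "f = (\<Sum>m\<in>?K. pconst (?c m) * ?y m) - (\<Sum>m\<in>?K. pconst (?c m) * ?y (s (e m)))"
    by simp
  also have "\<dots> = (\<Sum>m\<in>?K. pconst (?c m) * (?y m - ?y (s (e m))))"
    by (simp add: sum_subtractf right_diff_distrib)
  also have "\<dots> \<in> A"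
    by (intro mpoly_ideal_sum[OF A] mpoly_ideal_closed(3)[OF A] cong) (use s in auto)
  finally show ?thesis .
qed

text \<open>Listing the variables with multiplicity makes straightening an induction on lists; the
  order of the list is immaterial, as the product is commutative.\<close>

lemma monomial_eq_prod_list:
  assumes "Poly_Mapping.keys m \<subseteq> V"
  obtains xs where "set xs \<subseteq> V"
    "Poly_Mapping.single m (1 :: 'k::comm_ring_1) = prod_list (map pvar xs)"
proof -
  have "\<exists>xs. set xs \<subseteq> V \<and> Poly_Mapping.single m (1 :: 'k) = prod_list (map pvar xs)"
    using assms
  proof (induction m rule: update_induct)
    case const
    show ?case by (intro exI[of _ "[]"]) simp
  next
    case (update m v n)
    \<comment> \<open>Since \<open>v\<close> does not occur in \<open>m\<close>, overwriting its
      exponent amounts to multiplying by a power of \<open>v\<close>.\<close>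
    have upd: "Poly_Mapping.update v n m = Poly_Mapping.single v n + m"
      using update.hyps(1)
      by (intro poly_mapping_eqI) (auto simp: lookup_update lookup_add lookup_single when_def in_keys_iff)
    have keys: "v \<in> V" "Poly_Mapping.keys m \<subseteq> V"
      using update.prems update.hyps by (auto simp: keys_update)
    obtain xs where xs: "set xs \<subseteq> V"
        "Poly_Mapping.single m (1 :: 'k) = prod_list (map pvar xs)"
      using update.IH[OF keys(2)] by blast
    have "Poly_Mapping.single (Poly_Mapping.single v n) (1 :: 'k) = pvar v ^ n"
    proof (induction n)
      case (Suc n)
      have "Poly_Mapping.single v (Suc n) = Poly_Mapping.single v 1 + Poly_Mapping.single v n"
        by (simp flip: single_add)
      then show ?case
        unfolding power_Suc Suc.IH[symmetric] by (simp add: pvar_def mult_single)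
    qed simp
    then have "Poly_Mapping.single (Poly_Mapping.update v n m) (1 :: 'k) =
        prod_list (map pvar (replicate n v @ xs))"
      unfolding upd using mult_single[of "Poly_Mapping.single v n" "1 :: 'k" m 1]
      by (simp add: xs(2))
    then show ?case
      using xs(1) keys(1) by (intro exI[of _ "replicate n v @ xs"]) auto
  qed
  then show thesis using that by blast
qed


section \<open>Multichains\<close>

lemma order_ideal_inter:
  "order_ideal P leq I \<Longrightarrow> order_ideal P leq J \<Longrightarrow> order_ideal P leq (I \<inter> J)"
  unfolding order_ideal_def by blast

lemma order_ideal_union:
  "order_ideal P leq I \<Longrightarrow> order_ideal P leq J \<Longrightarrow> order_ideal P leq (I \<union> J)"
  unfolding order_ideal_def by blast

lemma multichainsE:
  assumes "I \<in> multichains r P leq"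
  shows "I 0 = {}" and "1 \<le> k \<Longrightarrow> k \<le> r \<Longrightarrow> order_ideal P leq (I k)"
    and "1 \<le> k \<Longrightarrow> k < r \<Longrightarrow> I k \<subseteq> I (Suc k)" and "r \<le> k \<Longrightarrow> I k = P"
  using assms by (simp_all add: multichains_def)

lemma multichains_inter:
  assumes I: "I \<in> multichains r P leq" and J: "J \<in> multichains r P leq"
  shows "(\<lambda>k. I k \<inter> J k) \<in> multichains r P leq"
  unfolding multichains_def mem_Collect_eq
  by (intro conjI ballI allI impI order_ideal_inter Int_mono)
    (simp_all add: multichainsE[OF I] multichainsE[OF J])

lemma multichains_union:
  assumes I: "I \<in> multichains r P leq" and J: "J \<in> multichains r P leq"
  shows "(\<lambda>k. I k \<union> J k) \<in> multichains r P leq"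
  unfolding multichains_def mem_Collect_eq
  by (intro conjI ballI allI impI order_ideal_union Un_mono)
    (simp_all add: multichainsE[OF I] multichainsE[OF J])

lemma multichain_Suc:
  assumes "I \<in> multichains r P leq"
  shows "I k \<subseteq> I (Suc k)"
proof (cases "k = 0 \<or> r \<le> k")
  case True
  then show ?thesis using assms by (auto simp: multichains_def)
next
  case False
  then show ?thesis using assms by (auto simp: multichains_def)
qed

lemma multichain_subset:
  assumes "I \<in> multichains r P leq"
  shows "I k \<subseteq> P"
proof (cases "k = 0 \<or> r \<le> k")
  case True
  then show ?thesis using assms by (auto simp: multichains_def)
next
  case False
  then show ?thesis using assms by (auto simp: multichains_def order_ideal_def)
qed

text \<open>Equivalently, the union over all choices of \<open>j\<close> positions in
  \<open>xs\<close> of the intersection of the chosen sets at place \<open>k\<close>; the order of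
  \<open>xs\<close> is immaterial. Index 0 yields the whole type and not \<open>P\<close>, so the
  chain of multichains starts at index 1.\<close>

definition level :: "('i \<Rightarrow> 'p set) list \<Rightarrow> nat \<Rightarrow> 'i \<Rightarrow> 'p set" where
  "level xs j k = {p. j \<le> length (filter (\<lambda>I. p \<in> I k) xs)}"

lemma level_0 [simp]: "level xs 0 = (\<lambda>k. UNIV)"
  by (simp add: level_def fun_eq_iff)

text \<open>A point in at least \<open>Suc j\<close> of the sets is so already within
  \<open>xs\<close>, or it lies in \<open>J k\<close> and in at least \<open>j\<close> of the
  others. This is the union that the exchange produces.\<close>

lemma level_Cons: "level (J # xs) (Suc j) = (\<lambda>k. J k \<inter> level xs j k \<union> level xs (Suc j) k)"
  by (auto simp: level_def fun_eq_iff)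

lemma level_Suc_subset: "level xs (Suc j) k \<subseteq> level xs j k"
  by (auto simp: level_def)

lemma level_Suc_length: "level xs (Suc (length xs)) = (\<lambda>k. {})"
  by (simp add: level_def fun_eq_iff not_le less_Suc_eq_le)

lemma length_filter_mono:
  assumes "\<And>x. x \<in> set xs \<Longrightarrow> Q x \<Longrightarrow> R x"
  shows "length (filter Q xs) \<le> length (filter R xs)"
  using assms by (induction xs) (auto simp: le_SucI)

text \<open>An implication from \<open>p \<in> I k\<close> to \<open>q \<in> I k'\<close> valid for
  all listed \<open>I\<close> passes to the levels, since counts can only grow; this gives
  down-closure and nesting. The bound \<open>1 \<le> j\<close> keeps the levels inside
  \<open>P\<close> and empty at place 0, while \<open>j \<le> length xs\<close> makes them equal to
  \<open>P\<close> from place \<open>r\<close> on.\<close>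

lemma level_multichain:
  assumes xs: "set xs \<subseteq> multichains r P leq" and j: "1 \<le> j" "j \<le> length xs"
  shows "level xs j \<in> multichains r P leq"
proof -
  have sub: "I k \<subseteq> P" if "I \<in> set xs" for I k
    using xs that multichain_subset by blast
  have nonempty: "\<exists>I\<in>set xs. p \<in> I k" if "p \<in> level xs j k" for p k
  proof -
    have "length (filter (\<lambda>I. p \<in> I k) xs) \<noteq> 0"
      using that j by (auto simp: level_def)
    then show ?thesis by (auto simp: filter_empty_conv)
  qed
  have mono: "q \<in> level xs j k'" if "p \<in> level xs j k" "\<And>I. I \<in> set xs \<Longrightarrow> p \<in> I k \<Longrightarrow> q \<in> I k'"
    for p q k k'
    using that(1) length_filter_mono[of xs "\<lambda>I. p \<in> I k" "\<lambda>I. q \<in> I k'"] that(2)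
    by (auto simp: level_def intro: order_trans)
  show ?thesis
    unfolding multichains_def order_ideal_def mem_Collect_eq
  proof (intro conjI ballI allI impI subsetI)
    show "level xs j 0 = {}"
      using nonempty[of _ 0] xs by (fastforce simp: multichains_def)
    show "p \<in> P" if "p \<in> level xs j k" for p k
      using nonempty[OF that] sub by blast
    show "q \<in> level xs j k" if "k \<in> {1..r}" "p \<in> level xs j k" "q \<in> P" "(q, p) \<in> leq" for k p q
      using that(2)
    proof (rule mono)
      fix I assume "I \<in> set xs" "p \<in> I k"
      then show "q \<in> I k" using that xs by (auto simp: multichains_def order_ideal_def)
    qed
    show "p \<in> level xs j (Suc k)" if "p \<in> level xs j k" for p k
      using that
    proof (rule mono)
      fix I assume "I \<in> set xs" "p \<in> I k"
      then show "p \<in> I (Suc k)" using xs multichain_Suc[of I] by blast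
    qed
    show "level xs j k = P" if "r \<le> k" for k
    proof
      show "level xs j k \<subseteq> P" using nonempty sub by blast
      show "P \<subseteq> level xs j k"
      proof
        fix p assume "p \<in> P"
        then have "filter (\<lambda>I. p \<in> I k) xs = xs"
          using xs that by (auto simp: filter_id_conv multichains_def)
        then show "p \<in> level xs j k" using j by (simp add: level_def)
      qed
    qed
  qed
qed

text \<open>Straightening: by induction the tail is already replaced by its levels, and
  \<open>J\<close> is then passed through them from the largest to the smallest. Each exchange
  leaves behind a level of the longer list as the union and carries the intersection on.\<close>

lemma prod_list_cong_levels:
  fixes P :: "'p set" and leq :: "'p rel" and r :: nat
    and A :: "(nat \<Rightarrow> 'p set, 'k::comm_ring_1) mpoly set"
  defines "M \<equiv> multichains r P leq"
  assumes A: "ideal A (mpoly_ring M)"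
    and ex: "\<And>I J. I \<in> M \<Longrightarrow> J \<in> M \<Longrightarrow>
      pvar I * pvar J - pvar (\<lambda>k. I k \<inter> J k) * pvar (\<lambda>k. I k \<union> J k) \<in> A"
    and xs: "set xs \<subseteq> M"
  shows "prod_list (map pvar xs) - (\<Prod>j<length xs. pvar (level xs (Suc j))) \<in> A"
  using xs
proof (induction xs)
  case Nil
  then show ?case using mpoly_ideal_closed(1)[OF A] by simp
next
  case (Cons J xs)
  then have J: "J \<in> M" and xs: "set xs \<subseteq> M" by auto
  have lev: "level (J # xs) (Suc j) \<in> M" if "j \<le> length xs" for j
    unfolding M_def by (rule level_multichain) (use Cons.prems that in \<open>auto simp: M_def\<close>)
  \<comment> \<open>For \<open>n = 0\<close> the level is the whole type, no multichain, but its
    intersection with \<open>J\<close> is \<open>J\<close> itself.\<close>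
  have J_lev: "(\<lambda>k. J k \<inter> level xs n k) \<in> M" if "n \<le> length xs" for n
    using J multichains_inter[OF J[unfolded M_def] level_multichain[OF xs[unfolded M_def]], of n] that
    by (cases n) (auto simp: M_def)
  \<comment> \<open>Invariant: the first \<open>n\<close> levels are updated, and what remains of
    \<open>J\<close> is its intersection with the last level passed.\<close>
  have ins: "pvar J * (\<Prod>j<n. pvar (level xs (Suc j))) -
      pvar (\<lambda>k. J k \<inter> level xs n k) * (\<Prod>j<n. pvar (level (J # xs) (Suc j))) \<in> A"
    if "n \<le> length xs" for n
    using that
  proof (induction n)
    case 0
    then show ?case using mpoly_ideal_closed(1)[OF A] by simp
  next
    case (Suc n)
    let ?C = "\<lambda>n k. J k \<inter> level xs n k" and ?L = "level xs (Suc n)"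
    let ?Q = "\<lambda>n. \<Prod>j<n. pvar (level (J # xs) (Suc j)) :: (nat \<Rightarrow> 'p set, 'k) mpoly"
    have L: "?L \<in> M"
      unfolding M_def by (rule level_multichain) (use xs Suc.prems in \<open>auto simp: M_def\<close>)
    have Q: "pvars (?Q n) \<subseteq> M"
      using lev Suc.prems by (intro order_trans[OF pvars_prod]) auto
    have 1: "pvar ?L * (pvar J * (\<Prod>j<n. pvar (level xs (Suc j)))) - pvar ?L * (pvar (?C n) * ?Q n) \<in> A"
      by (intro mpoly_ideal_mult_cong[OF A] Suc.IH) (use Suc.prems L in auto)
    have "pvar (?C n) * pvar ?L - pvar (\<lambda>k. ?C n k \<inter> ?L k) * pvar (\<lambda>k. ?C n k \<union> ?L k) \<in> A"
      using J_lev[of n] L Suc.prems by (intro ex) auto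
    \<comment> \<open>Levels decrease, so the intersection with \<open>level xs n\<close> is
      absorbed and the remainder keeps its form.\<close>
    also have "(\<lambda>k. ?C n k \<inter> ?L k) = ?C (Suc n)"
      using level_Suc_subset[of xs n] by fastforce
    also have "(\<lambda>k. ?C n k \<union> ?L k) = level (J # xs) (Suc n)"
      by (simp add: level_Cons)
    finally have 2: "?Q n * (pvar (?C n) * pvar ?L) -
        ?Q n * (pvar (?C (Suc n)) * pvar (level (J # xs) (Suc n))) \<in> A"
      by (rule mpoly_ideal_mult_cong[OF A _ Q])
    show ?case
      using mpoly_ideal_closed(2)[OF A 1 2] by (simp add: algebra_simps)
  qed
  \<comment> \<open>No point lies in more than \<open>length xs\<close> sets of the tail, so the
    final remainder is exactly the additional last level.\<close>
  have "(\<lambda>k. J k \<inter> level xs (length xs) k) = level (J # xs) (Suc (length xs))"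
    by (simp add: level_Cons level_Suc_length)
  with ins[OF order_refl]
  have "pvar J * (\<Prod>j<length xs. pvar (level xs (Suc j))) -
      (\<Prod>j<length (J # xs). pvar (level (J # xs) (Suc j))) \<in> A"
    by (simp add: mult.commute)
  then show ?case
    using mpoly_ideal_trans[OF A mpoly_ideal_mult_cong[OF A Cons.IH[OF xs], of "pvar J"]] J
    by simp
qed


section \<open>Exponents of multichain monomials\<close>

text \<open>The exponent vector of the generator attached to \<open>I\<close>; comparing images of
  monomials becomes comparing sums of such vectors.\<close>

definition multichain_exponent :: "nat \<Rightarrow> (nat \<Rightarrow> 'p set) \<Rightarrow> (nat \<times> 'p) \<Rightarrow>\<^sub>0 nat" where
  "multichain_exponent r I = (\<Sum>k=1..r. \<Sum>p\<in>I k - I (k - 1). Poly_Mapping.single (k, p) 1)"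

lemma prod_single_one:
  "(\<Prod>i\<in>B. Poly_Mapping.single (m i) (1 :: 'k::comm_ring_1)) = Poly_Mapping.single (\<Sum>i\<in>B. m i) 1"
  by (induction B rule: infinite_finite_induct) (auto simp: mult_single)

lemma multichain_monomial_eq_single:
  "(multichain_monomial r I :: (nat \<times> 'p, 'k::comm_ring_1) mpoly) =
    Poly_Mapping.single (multichain_exponent r I) 1"
  by (simp add: multichain_monomial_def multichain_exponent_def pvar_def prod_single_one)

text \<open>Finiteness of \<open>P\<close> keeps the inner sums from defaulting to 0. Places beyond
  \<open>r\<close> need no case of their own: the chain is constant there, so nothing
  enters.\<close>

lemma lookup_multichain_exponent:
  assumes I: "I \<in> multichains r P leq" and "finite P"
  shows "Poly_Mapping.lookup (multichain_exponent r I) (0, p) = 0"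
    and "Poly_Mapping.lookup (multichain_exponent r I) (Suc k, p) = of_bool (p \<in> I (Suc k) - I k)"
proof -
  have fin: "finite (I k)" for k
    using multichain_subset[OF I] \<open>finite P\<close> by (rule finite_subset)
  have inner: "(\<Sum>q\<in>I k' - I (k' - 1). Poly_Mapping.lookup (Poly_Mapping.single (k', q) (1::nat)) (k, p)) =
      (if k' = k then of_bool (p \<in> I k - I (k - 1)) else 0)" for k k'
    using fin by (auto simp: lookup_single when_def sum.delta)
  have *: "Poly_Mapping.lookup (multichain_exponent r I) (k, p) =
      (if k \<in> {1..r} then of_bool (p \<in> I k - I (k - 1)) else 0)" for k
    unfolding multichain_exponent_def lookup_sum inner by (simp add: sum.delta')
  show "Poly_Mapping.lookup (multichain_exponent r I) (0, p) = 0"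
    by (simp add: *)
  have "I (Suc k) - I k = {}" if "\<not> Suc k \<le> r"
    using I that by (simp add: multichains_def)
  then show "Poly_Mapping.lookup (multichain_exponent r I) (Suc k, p) = of_bool (p \<in> I (Suc k) - I k)"
    by (auto simp: *)
qed

text \<open>Along an increasing chain each entry is a difference of consecutive indicators, and the
  indicators of intersection and union add up to those of the two sets. This puts the binomials into
  the kernel.\<close>

lemma multichain_exponent_inter_union:
  assumes I: "I \<in> multichains r P leq" and J: "J \<in> multichains r P leq" and P: "finite P"
  shows "multichain_exponent r (\<lambda>k. I k \<inter> J k) + multichain_exponent r (\<lambda>k. I k \<union> J k) =
    multichain_exponent r I + multichain_exponent r J"
proof (rule poly_mapping_eqI)
  fix v :: "nat \<times> 'a"
  obtain k p where v: "v = (k, p)" by fastforce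
  note look = lookup_multichain_exponent[OF I P] lookup_multichain_exponent[OF J P]
    lookup_multichain_exponent[OF multichains_inter[OF I J] P]
    lookup_multichain_exponent[OF multichains_union[OF I J] P]
  show "Poly_Mapping.lookup
      (multichain_exponent r (\<lambda>k. I k \<inter> J k) + multichain_exponent r (\<lambda>k. I k \<union> J k)) v =
    Poly_Mapping.lookup (multichain_exponent r I + multichain_exponent r J) v"
  proof (cases k)
    case 0
    then show ?thesis by (simp only: v lookup_add look)
  next
    case (Suc i)
    have "p \<in> I i \<Longrightarrow> p \<in> I (Suc i)" "p \<in> J i \<Longrightarrow> p \<in> J (Suc i)"
      using multichain_Suc[OF I] multichain_Suc[OF J] by blast+
    then show ?thesis
      unfolding v Suc lookup_add look Int_iff Un_iff Diff_iff
      by (cases "p \<in> I i"; cases "p \<in> J i"; cases "p \<in> I (Suc i)"; cases "p \<in> J (Suc i)") simp_all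
  qed
qed

text \<open>For a single chain the sum telescopes to the indicator of \<open>p \<in> I k\<close>.
  Hence the total exponent determines all levels.\<close>

lemma length_filter_eq_sum_exponent:
  assumes xs: "set xs \<subseteq> multichains r P leq" and P: "finite P"
  shows "length (filter (\<lambda>I. p \<in> I k) xs) =
    (\<Sum>i<k. Poly_Mapping.lookup (sum_list (map (multichain_exponent r) xs)) (Suc i, p))"
  using xs
proof (induction xs)
  case Nil
  then show ?case by simp
next
  case (Cons I xs)
  then have I: "I \<in> multichains r P leq" by simp
  have "(\<Sum>i<k. Poly_Mapping.lookup (multichain_exponent r I) (Suc i, p)) = of_bool (p \<in> I k)"
  proof (induction k)
    case 0
    then show ?case using I by (simp add: multichains_def)
  next
    case (Suc k)
    then show ?case
      using multichain_Suc[OF I, of k] by (auto simp: lookup_multichain_exponent[OF I P])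
  qed
  then show ?case
    using Cons by (simp add: lookup_add sum.distrib)
qed

text \<open>Equal exponents force equal levels and equal lengths, so both products are congruent to
  the same product over levels.\<close>

lemma prod_list_cong_exponent:
  fixes P :: "'p set" and leq :: "'p rel" and r :: nat
    and A :: "(nat \<Rightarrow> 'p set, 'k::comm_ring_1) mpoly set"
  defines "M \<equiv> multichains r P leq"
  assumes P: "finite P" "P \<noteq> {}"
    and A: "ideal A (mpoly_ring M)"
    and ex: "\<And>I J. I \<in> M \<Longrightarrow> J \<in> M \<Longrightarrow>
      pvar I * pvar J - pvar (\<lambda>k. I k \<inter> J k) * pvar (\<lambda>k. I k \<union> J k) \<in> A"
    and xs: "set xs \<subseteq> M" and ys: "set ys \<subseteq> M"
    and eq: "sum_list (map (multichain_exponent r) xs) = sum_list (map (multichain_exponent r) ys)"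
  shows "prod_list (map pvar xs) - prod_list (map pvar ys) \<in> A"
proof -
  have count: "length (filter (\<lambda>I. p \<in> I k) xs) = length (filter (\<lambda>I. p \<in> I k) ys)" for k p
    using length_filter_eq_sum_exponent[OF xs[unfolded M_def] P(1)]
      length_filter_eq_sum_exponent[OF ys[unfolded M_def] P(1)] eq by simp
  then have lev: "level xs = level ys"
    by (simp add: level_def fun_eq_iff)
  \<comment> \<open>Every multichain has \<open>P\<close> at place \<open>r\<close>, so the count of
    any \<open>p \<in> P\<close> there is the length of the list.\<close>
  obtain p where p: "p \<in> P" using P(2) by blast
  have "filter (\<lambda>I. p \<in> I r) zs = zs" if "set zs \<subseteq> M" for zs
    using p that by (auto simp: filter_id_conv M_def multichains_def)
  with count[of p r] xs ys have len: "length xs = length ys" by simp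
  have "prod_list (map pvar xs) - (\<Prod>j<length xs. pvar (level xs (Suc j))) \<in> A"
    and ys': "prod_list (map pvar ys) - (\<Prod>j<length ys. pvar (level ys (Suc j))) \<in> A"
    using prod_list_cong_levels[OF A[unfolded M_def] ex[unfolded M_def]] xs ys
    unfolding M_def by blast+
  moreover have "(\<Prod>j<length ys. pvar (level ys (Suc j))) - prod_list (map pvar ys) \<in> A"
    using mpoly_ideal_uminus[OF A ys'] by simp
  ultimately show ?thesis
    using mpoly_ideal_trans[OF A] unfolding lev len by blast
qed


section \<open>The presentation ideal\<close>

text \<open>A homomorphism is constrained on the carrier only, hence the conditions on variables.
  The target is any record with the polynomial operations, which covers the Hibi ring with its
  smaller carrier.\<close>

lemma algebra_hom_into_mpoly_ring:
  assumes "\<phi> \<in> algebra_hom (mpoly_ring V) (B :: ('w, 'k::comm_ring_1) mpoly ring)"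
    and "mult B = (*)" "add B = (+)" "one B = 1"
  shows "\<phi> (pconst c) = pconst c"
    and "pvars f \<subseteq> V \<Longrightarrow> pvars g \<subseteq> V \<Longrightarrow> \<phi> (f + g) = \<phi> f + \<phi> g"
    and "pvars f \<subseteq> V \<Longrightarrow> pvars g \<subseteq> V \<Longrightarrow> \<phi> (f * g) = \<phi> f * \<phi> g"
  using assms by (auto simp: algebra_hom_def ring_hom_def)

theorem corollary1p32:
  fixes P :: "'p set" and leq :: "'p rel" and r :: nat
    and \<phi> :: "(nat \<Rightarrow> 'p set, 'k::field) mpoly \<Rightarrow> (nat \<times> 'p, 'k) mpoly"
  assumes "finite P" and "P \<noteq> {}" and "partial_order_on P leq" and "r \<ge> 1"
    and "\<phi> \<in> algebra_hom (mpoly_ring (multichains r P leq)) (hibi_ring r P leq)"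
    and "\<And>I. I \<in> multichains r P leq \<Longrightarrow> \<phi> (pvar I) = multichain_monomial r I"
  shows "a_kernel (mpoly_ring (multichains r P leq)) (hibi_ring r P leq) \<phi> =
    Idl\<^bsub>mpoly_ring (multichains r P leq)\<^esub>
      {pvar I * pvar J - pvar (\<lambda>k. I k \<inter> J k) * pvar (\<lambda>k. I k \<union> J k) | I J.
         I \<in> multichains r P leq \<and> J \<in> multichains r P leq \<and> \<not> I \<le> J \<and> \<not> J \<le> I}"
proof -
  let ?M = "multichains r P leq"
  let ?T = "mpoly_ring ?M :: (nat \<Rightarrow> 'p set, 'k) mpoly ring"
  let ?R = "hibi_ring r P leq :: (nat \<times> 'p, 'k) mpoly ring"
  let ?b = "\<lambda>I J. pvar I * pvar J - pvar (\<lambda>k. I k \<inter> J k) * pvar (\<lambda>k. I k \<union> J k) ::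
    (nat \<Rightarrow> 'p set, 'k) mpoly"
  let ?G = "{?b I J | I J. I \<in> ?M \<and> J \<in> ?M \<and> \<not> I \<le> J \<and> \<not> J \<le> I}"
  interpret T: cring ?T by (rule mpoly_ring_cring)
  have R: "mult ?R = (*)" "add ?R = (+)" "one ?R = 1" "zero ?R = 0"
    by (simp_all add: hibi_ring_def)
  note hom = algebra_hom_into_mpoly_ring[OF assms(5) R(1-3)]
  have hom0: "\<phi> 0 = 0" and hom1: "\<phi> 1 = 1"
    using hom(1)[of 0] hom(1)[of 1] by simp_all
  have \<phi>_var: "\<phi> (pvar I) = Poly_Mapping.single (multichain_exponent r I) 1" if "I \<in> ?M" for I
    using assms(6)[OF that] by (simp add: multichain_monomial_eq_single)
  have ker: "a_kernel ?T ?R \<phi> = {f. pvars f \<subseteq> ?M \<and> \<phi> f = 0}"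
    by (simp add: a_kernel_def' R)

  \<comment> \<open>The binomials lie in the kernel\<close>
  have prod_in: "pvars (pvar I * pvar J :: (nat \<Rightarrow> 'p set, 'k) mpoly) \<subseteq> ?M"
    if "I \<in> ?M" "J \<in> ?M" for I J
    using that by (intro order_trans[OF pvars_mult]) auto
  have b_in: "pvars (?b I J) \<subseteq> ?M" if "I \<in> ?M" "J \<in> ?M" for I J
    using prod_in[OF that] prod_in[OF multichains_inter[OF that] multichains_union[OF that]]
    unfolding diff_conv_add_uminus by (intro order_trans[OF pvars_add]) (simp add: pvars_uminus)
  have \<phi>_b: "\<phi> (?b I J) = 0" if IJ: "I \<in> ?M" "J \<in> ?M" for I J
  proof -
    note ui = multichains_inter[OF IJ] multichains_union[OF IJ]
    \<comment> \<open>The available rules concern sums and products, so the subtracted term is moved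
      to the other side.\<close>
    have "\<phi> (?b I J) + \<phi> (pvar (\<lambda>k. I k \<inter> J k) * pvar (\<lambda>k. I k \<union> J k)) = \<phi> (pvar I * pvar J)"
      using hom(2)[OF b_in[OF IJ] prod_in[OF ui]] by simp
    then show ?thesis
      using multichain_exponent_inter_union[OF IJ assms(1)]
      by (simp add: hom(3) \<phi>_var IJ ui mult_single)
  qed

  have G: "?G \<subseteq> carrier ?T"
    using b_in by auto
  have A: "ideal (Idl\<^bsub>?T\<^esub> ?G) ?T"
    by (rule T.genideal_ideal[OF G])
  have "subring (subalgebra_generated ({1..r} \<times> P) (multichain_monomial r ` ?M))
      (mpoly_ring ({1..r} \<times> P) :: (nat \<times> 'p, 'k) mpoly ring)"
    by (rule subalgebra_generated_subring) (use multichain_monomial_carrier in blast)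
  then have "ring ?R"
    unfolding hibi_ring_def by (intro ring.subring_is_ring cring.axioms(1) mpoly_ring_cring)
  then have "ring_hom_ring ?T ?R \<phi>"
    using assms(5) by (intro ring_hom_ringI2 T.ring_axioms) (auto simp: algebra_hom_def)
  then have "ideal (a_kernel ?T ?R \<phi>) ?T"
    by (rule ring_hom_ring.kernel_is_ideal)
  moreover have "?G \<subseteq> a_kernel ?T ?R \<phi>"
    using b_in \<phi>_b unfolding ker by blast
  ultimately have "Idl\<^bsub>?T\<^esub> ?G \<subseteq> a_kernel ?T ?R \<phi>"
    by (rule T.genideal_minimal)

  \<comment> \<open>Exchange for arbitrary pairs and images of products of variables\<close>
  have ex: "?b I J \<in> Idl\<^bsub>?T\<^esub> ?G" if IJ: "I \<in> ?M" "J \<in> ?M" for I J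
  proof (cases "I \<le> J \<or> J \<le> I")
    case True
    \<comment> \<open>For comparable multichains the exchange merely permutes the two factors, so
      the binomial is 0.\<close>
    then consider "(\<lambda>k. I k \<inter> J k) = I" "(\<lambda>k. I k \<union> J k) = J"
      | "(\<lambda>k. I k \<inter> J k) = J" "(\<lambda>k. I k \<union> J k) = I"
      by (auto simp: le_fun_def fun_eq_iff)
    then have "?b I J = 0"
      by cases (simp_all add: mult.commute)
    then show ?thesis using mpoly_ideal_closed(1)[OF A] by simp
  next
    case False
    then have "?b I J \<in> ?G" using IJ by blast
    then show ?thesis using T.genideal_self[OF G] by blast
  qed
  have \<phi>_prod: "\<phi> (prod_list (map pvar xs)) =
      Poly_Mapping.single (sum_list (map (multichain_exponent r) xs)) 1 \<and>
      pvars (prod_list (map pvar xs) :: (nat \<Rightarrow> 'p set, 'k) mpoly) \<subseteq> ?M"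
    if "set xs \<subseteq> ?M" for xs
    using that
  proof (induction xs)
    case Nil
    then show ?case by (simp add: hom1)
  next
    case (Cons I xs)
    then have I: "I \<in> ?M" by simp
    have "pvars (pvar I * prod_list (map pvar xs) :: (nat \<Rightarrow> 'p set, 'k) mpoly) \<subseteq> ?M"
      using Cons by (intro order_trans[OF pvars_mult]) auto
    then show ?case
      using Cons I by (simp add: hom(3) \<phi>_var mult_single)
  qed

  \<comment> \<open>The kernel lies in the ideal of the binomials\<close>
  have "f \<in> Idl\<^bsub>?T\<^esub> ?G" if f: "pvars f \<subseteq> ?M" "\<phi> f = 0" for f
  proof -
    let ?K = "Poly_Mapping.keys f"
    have "\<forall>m\<in>?K. \<exists>xs. set xs \<subseteq> ?M \<and> Poly_Mapping.single m (1 :: 'k) = prod_list (map pvar xs)"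
    proof
      fix m assume "m \<in> ?K"
      then have "Poly_Mapping.keys m \<subseteq> ?M" using f(1) by (auto simp: pvars_def)
      then show "\<exists>xs. set xs \<subseteq> ?M \<and> Poly_Mapping.single m (1 :: 'k) = prod_list (map pvar xs)"
        using monomial_eq_prod_list by metis
    qed
    then obtain l where l: "\<And>m. m \<in> ?K \<Longrightarrow> set (l m) \<subseteq> ?M"
        "\<And>m. m \<in> ?K \<Longrightarrow> Poly_Mapping.single m (1 :: 'k) = prod_list (map pvar (l m))"
      by metis
    \<comment> \<open>For \<open>m \<in> ?K\<close>, the exponent of the image of the monomial
      \<open>m\<close>, read off the chosen factorization \<open>l m\<close>.\<close>
    define e where "e m = sum_list (map (multichain_exponent r) (l m))" for m
    have img: "\<phi> (Poly_Mapping.single m c) = Poly_Mapping.single (e m) c"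
      "pvars (Poly_Mapping.single m c) \<subseteq> ?M" if "m \<in> ?K" for m c
    proof -
      note \<phi>_prod[OF l(1)[OF that], folded l(2)[OF that]]
      then show "\<phi> (Poly_Mapping.single m c) = Poly_Mapping.single (e m) c"
        unfolding single_eq_pconst_mult[of _ c] by (simp add: hom(1,3) e_def)
      show "pvars (Poly_Mapping.single m c) \<subseteq> ?M"
        using that f(1) by (auto simp: pvars_def split: if_splits)
    qed
    have "\<phi> (\<Sum>m\<in>B. Poly_Mapping.single m (Poly_Mapping.lookup f m)) =
        (\<Sum>m\<in>B. Poly_Mapping.single (e m) (Poly_Mapping.lookup f m)) \<and>
        pvars (\<Sum>m\<in>B. Poly_Mapping.single m (Poly_Mapping.lookup f m)) \<subseteq> ?M"
      if "finite B" "B \<subseteq> ?K" for B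
      using that
    proof (induction B)
      case empty
      then show ?case by (simp add: hom0)
    next
      case (insert m B)
      then show ?case
        using order_trans[OF pvars_add Un_least[OF img(2)]] img(1)[of m]
        by (simp add: hom(2) img(2))
    qed
    from this[of ?K] have \<phi>_f: "(\<Sum>m\<in>?K. Poly_Mapping.single (e m) (Poly_Mapping.lookup f m)) = 0"
      unfolding mpoly_eq_sum_single[of f, symmetric] f(2) by simp
    show ?thesis
    proof (rule fibrewise_zero_in_ideal[OF A])
      show "Poly_Mapping.single m 1 - Poly_Mapping.single n 1 \<in> Idl\<^bsub>?T\<^esub> ?G"
        if "m \<in> ?K" "n \<in> ?K" "e m = e n" for m n
        unfolding l(2)[OF that(1)] l(2)[OF that(2)]
        by (rule prod_list_cong_exponent[OF assms(1,2) A ex l(1) l(1)])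
          (use that in \<open>auto simp: e_def\<close>)
      \<comment> \<open>The sum over a fibre is the coefficient of \<open>\<phi> f\<close> at the
        exponent \<open>E\<close>, and \<open>\<phi> f = 0\<close>.\<close>
      show "(\<Sum>m | m \<in> ?K \<and> e m = E. Poly_Mapping.lookup f m) = 0" for E
      proof -
        have "(\<Sum>m | m \<in> ?K \<and> e m = E. Poly_Mapping.lookup f m) =
            (\<Sum>m\<in>?K. if e m = E then Poly_Mapping.lookup f m else 0)"
          using sum.inter_filter[of ?K "Poly_Mapping.lookup f" "\<lambda>m. e m = E"] by simp
        also have "\<dots> = Poly_Mapping.lookup
            (\<Sum>m\<in>?K. Poly_Mapping.single (e m) (Poly_Mapping.lookup f m)) E"
          by (simp only: lookup_sum lookup_single when_def)
        finally show ?thesis by (simp add: \<phi>_f)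
      qed
    qed
  qed
  with \<open>Idl\<^bsub>?T\<^esub> ?G \<subseteq> a_kernel ?T ?R \<phi>\<close> show ?thesis
    unfolding ker by blast
qed

end
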